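(* Let $n\ge1$, $w\in\mathbb{R}^n_{>0}$, $1/2\le\beta<1$, $r_0>0$, $c_0,x^*\in\mathbb{R}^n$, $R_k=\beta^kr_0$, $0\le\theta\le2\beta-1$, $\Delta=2\beta-1-\theta$. Let $s_k\in\{-1,+1\}^n$, $c_{k+1}=c_k-(1-\beta)R_k\,w\odot s_k$, $u_{k,i}=(c_{k,i}-x_i^* )/w_i$, $M_k=\max_i|u_{k,i}|$, and assume $M_0\le r_0$. Suppose that for each $k$ the chosen sign is correct in every coordinate $i$ with $|u_{k,i}|>\theta M_k+\eta_k$, where $\eta_k\ge0$. Define $$d_0=0,\qquad d_{k+1}=\max\{d_k,\ \theta d_k+\eta_k-\Delta R_k\}.$$ Then for every $K\ge1$, $$M_K\le R_K+d_K\le R_K+\frac{\max_{0\le j<K}[\eta_j-\Delta R_j]_+}{1-\theta}.$$ If $\eta_k\le\bar\eta$ for all $k$, then $$M_\infty\le\frac{\bar\eta}{1-\theta}.$$ The coefficient $1/(1-\theta)$ is sharp already in one dimension for this band model: for $n=1$ no bound $M_\infty\le C\bar\eta$ with $C<1/(1-\theta)$ holds in general under these hypotheses.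
   Context: $[t]_+=\max\{t,0\}$; $\odot$ is the componentwise product. The sign $s_{k,i}$ is correct when $s_{k,i}=\operatorname{sign}(c_{k,i}-x_i^* )$, i.e. the centre moves towards the target in coordinate $i$. In coordinates not satisfying $|u_{k,i}|>\theta M_k+\eta_k$, $s_{k,i}\in\{-1,+1\}$ is arbitrary. Since the displacements are summable, $M_\infty=\lim_kM_k$ exists. *)

theory Defs
  imports "HOL-Analysis.Analysis"
begin

definition radius :: "real \<Rightarrow> real \<Rightarrow> nat \<Rightarrow> real" where
  "radius \<beta> r0 k = \<beta> ^ k * r0"

definition Delta :: "real \<Rightarrow> real \<Rightarrow> real" where
  "Delta \<beta> \<theta> = 2 * \<beta> - 1 - \<theta>"

definition scaled_err ::
  "real ^ 'n \<Rightarrow> real ^ 'n \<Rightarrow> (nat \<Rightarrow> real ^ 'n) \<Rightarrow> nat \<Rightarrow> real ^ 'n" where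
  "scaled_err w xstar c k = (\<chi> i. (c k $ i - xstar $ i) / w $ i)"

definition max_err ::
  "real ^ 'n \<Rightarrow> real ^ 'n \<Rightarrow> (nat \<Rightarrow> real ^ 'n) \<Rightarrow> nat \<Rightarrow> real" where
  "max_err w xstar c k = Max (range (\<lambda>i. \<bar>scaled_err w xstar c k $ i\<bar>))"

text \<open>
  The standing hypotheses on a run of the band model, apart from the conditions on the
  parameters \<open>\<beta>\<close> and \<open>\<theta>\<close>. The initial centre is \<open>c 0\<close>. The last conjunct constrains
  the sign only outside the band; inside it any sign in \<open>{-1, 1}\<close> is allowed.
  A coordinate outside the band has nonzero error, so \<open>sgn\<close> is not evaluated at \<open>0\<close> there.
\<close>

definition band_run ::
  "real \<Rightarrow> real \<Rightarrow> real \<Rightarrow> real ^ 'n \<Rightarrow> real ^ 'n \<Rightarrow> (nat \<Rightarrow> real ^ 'n) \<Rightarrow>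
   (nat \<Rightarrow> real ^ 'n) \<Rightarrow> (nat \<Rightarrow> real) \<Rightarrow> bool" where
  "band_run \<beta> \<theta> r0 w xstar c s \<eta> \<longleftrightarrow>
     0 < r0 \<and>
     (\<forall>i. 0 < w $ i) \<and>
     (\<forall>k i. s k $ i \<in> {-1, 1}) \<and>
     (\<forall>k. c (Suc k) = c k - ((1 - \<beta>) * radius \<beta> r0 k) *\<^sub>R (\<chi> i. w $ i * s k $ i)) \<and>
     max_err w xstar c 0 \<le> r0 \<and>
     (\<forall>k. 0 \<le> \<eta> k) \<and>
     (\<forall>k i. \<bar>scaled_err w xstar c k $ i\<bar> > \<theta> * max_err w xstar c k + \<eta> k \<longrightarrow>
        s k $ i = sgn (c k $ i - xstar $ i))"

primrec excess :: "real \<Rightarrow> real \<Rightarrow> real \<Rightarrow> (nat \<Rightarrow> real) \<Rightarrow> nat \<Rightarrow> real" where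
  "excess \<beta> \<theta> r0 \<eta> 0 = 0"
| "excess \<beta> \<theta> r0 \<eta> (Suc k) =
     max (excess \<beta> \<theta> r0 \<eta> k)
         (\<theta> * excess \<beta> \<theta> r0 \<eta> k + \<eta> k - Delta \<beta> \<theta> * radius \<beta> r0 k)"

end

theory Submission
  imports Defs
begin

text \<open>
  The radius \<open>R\<^sub>k\<close> is exactly the total displacement, measured in scaled coordinates, that is
  still available from step \<open>k\<close> on: step \<open>k\<close> moves by \<open>(1 - \<beta>) R\<^sub>k = R\<^sub>k - R\<^sub>k\<^sub>+\<^sub>1\<close>. A correct
  step therefore lowers an error above the step length by as much as the radius shrinks, so it
  keeps the slack \<open>M\<^sub>k - R\<^sub>k\<close>; an overshooting step leaves an error of at most
  \<open>(1 - \<beta>) R\<^sub>k \<le> R\<^sub>k\<^sub>+\<^sub>1\<close>, because \<open>\<beta> \<ge> 1/2\<close>. A wrong step is possible only when the error is at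
  most \<open>\<theta> M\<^sub>k + \<eta>\<^sub>k\<close>, and from \<open>M\<^sub>k \<le> R\<^sub>k + d\<^sub>k\<close> it leads to an error of at most
  \<open>\<theta> (R\<^sub>k + d\<^sub>k) + \<eta>\<^sub>k + (1 - \<beta>) R\<^sub>k = R\<^sub>k\<^sub>+\<^sub>1 + (\<theta> d\<^sub>k + \<eta>\<^sub>k - \<Delta> R\<^sub>k)\<close>.
  These cases are the terms of the recursion for the excess \<open>d\<close> (\<open>max_err_le_radius_excess\<close>).
  The excess stays below \<open>A / (1 - \<theta>)\<close>, the fixed point of \<open>d \<mapsto> \<theta> d + A\<close>, when every forcing
  term \<open>\<eta>\<^sub>j - \<Delta> R\<^sub>j\<close> is at most \<open>A\<close> (\<open>excess_le_fixed_point\<close>). Since \<open>\<Delta> \<ge> 0\<close>, a uniform noise bound can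
  serve as \<open>A\<close>, and \<open>R\<^sub>k \<rightarrow> 0\<close> then gives the bound on the limit of \<open>M\<^sub>k\<close>.

  Convergence holds because \<open>M\<^sub>k + R\<^sub>k\<close> is nonincreasing and bounded below, while \<open>R\<^sub>k\<close> tends to \<open>0\<close>.

  The bound on the limit is attained: a one-dimensional centre that starts at distance \<open>r\<^sub>0 = 1\<close> and
  always moves away from the target has error \<open>2 - \<beta>\<^sup>k\<close>, and the constant noise level
  \<open>\<eta> = 2 (1 - \<theta>)\<close> is just large enough to keep it inside the band forever. The error tends to
  \<open>2 = \<eta> / (1 - \<theta>)\<close> (\<open>escaping_run\<close>).
\<close>

lemma abs_scaled_err_le_max_err:
  "\<bar>scaled_err w xstar c k $ i\<bar> \<le> max_err w xstar c k"
  unfolding max_err_def by (rule Max_ge) auto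

lemma max_err_le_iff:
  "max_err w xstar c k \<le> B \<longleftrightarrow> (\<forall>i. \<bar>scaled_err w xstar c k $ i\<bar> \<le> B)"
  unfolding max_err_def by (subst Max_le_iff) auto

lemma max_err_nonneg: "0 \<le> max_err w xstar c k"
  using abs_scaled_err_le_max_err[of w xstar c k undefined] by linarith

lemma radius_Suc: "radius \<beta> r0 (Suc k) = \<beta> * radius \<beta> r0 k"
  by (simp add: radius_def)

lemma radius_nonneg: "0 \<le> \<beta> \<Longrightarrow> 0 \<le> r0 \<Longrightarrow> 0 \<le> radius \<beta> r0 k"
  by (simp add: radius_def)

lemma radius_tendsto_0: "0 \<le> \<beta> \<Longrightarrow> \<beta> < 1 \<Longrightarrow> radius \<beta> r0 \<longlonglongrightarrow> 0"
  unfolding radius_def by (intro tendsto_mult_left_zero LIMSEQ_power_zero) simp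

lemma scaled_err_Suc:
  assumes "band_run \<beta> \<theta> r0 w xstar c s \<eta>"
  shows "scaled_err w xstar c (Suc k) $ i
           = scaled_err w xstar c k $ i - (1 - \<beta>) * radius \<beta> r0 k * s k $ i"
proof -
  have w: "w $ i \<noteq> 0"
    using assms unfolding band_run_def by (metis less_irrefl)
  have "c (Suc k) $ i = c k $ i - (1 - \<beta>) * radius \<beta> r0 k * (w $ i * s k $ i)"
    using assms unfolding band_run_def by simp
  with w show ?thesis
    by (simp add: scaled_err_def field_simps)
qed

lemma band_run_sign:
  assumes "band_run \<beta> \<theta> r0 w xstar c s \<eta>"
    and "\<bar>scaled_err w xstar c k $ i\<bar> > \<theta> * max_err w xstar c k + \<eta> k"
  shows "s k $ i = sgn (scaled_err w xstar c k $ i)"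
proof -
  have "0 < w $ i" and "s k $ i = sgn (c k $ i - xstar $ i)"
    using assms unfolding band_run_def by blast+
  then show ?thesis
    by (simp add: scaled_err_def sgn_divide)
qed

lemma band_run_abs_sign:
  assumes "band_run \<beta> \<theta> r0 w xstar c s \<eta>"
  shows "\<bar>s k $ i\<bar> = 1"
proof -
  have "s k $ i \<in> {-1, 1}"
    using assms unfolding band_run_def by blast
  then show ?thesis by auto
qed

lemma abs_scaled_err_Suc_le:
  assumes run: "band_run \<beta> \<theta> r0 w xstar c s \<eta>" and \<beta>: "0 \<le> \<beta>" "\<beta> \<le> 1"
  shows "\<bar>scaled_err w xstar c (Suc k) $ i\<bar>
           \<le> \<bar>scaled_err w xstar c k $ i\<bar> + (1 - \<beta>) * radius \<beta> r0 k"
proof -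
  define h where "h = (1 - \<beta>) * radius \<beta> r0 k"
  have "0 < r0"
    using run unfolding band_run_def by blast
  then have "0 \<le> h"
    using \<beta> by (simp add: h_def radius_nonneg)
  then have "\<bar>h * s k $ i\<bar> = h"
    by (simp add: abs_mult band_run_abs_sign[OF run])
  then show ?thesis
    unfolding scaled_err_Suc[OF run] h_def[symmetric] by linarith
qed

text \<open>
  The three bounds are those of a correct step that does not overshoot, of a correct step that does,
  and of a wrong step, which needs an error inside the band.
\<close>

lemma max_err_Suc_le:
  fixes k r0 \<beta>
  defines "h \<equiv> (1 - \<beta>) * radius \<beta> r0 k"
  assumes run: "band_run \<beta> \<theta> r0 w xstar c s \<eta>" and \<beta>: "0 \<le> \<beta>" "\<beta> \<le> 1"
  shows "max_err w xstar c (Suc k)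
           \<le> max (max_err w xstar c k - h) (max h (\<theta> * max_err w xstar c k + \<eta> k + h))"
  unfolding max_err_le_iff
proof
  fix i
  let ?u = "scaled_err w xstar c k $ i" and ?M = "max_err w xstar c k"
  show "\<bar>scaled_err w xstar c (Suc k) $ i\<bar> \<le> max (?M - h) (max h (\<theta> * ?M + \<eta> k + h))"
  proof (cases "\<bar>?u\<bar> > \<theta> * ?M + \<eta> k")
    case True
    note sign = band_run_sign[OF run this]
    with band_run_abs_sign[OF run, of k i] have "?u \<noteq> 0" by auto
    moreover have "0 \<le> h"
      using run \<beta> unfolding band_run_def h_def by (simp add: radius_nonneg)
    ultimately have "\<bar>scaled_err w xstar c (Suc k) $ i\<bar> \<le> max (\<bar>?u\<bar> - h) h"
      unfolding scaled_err_Suc[OF run] h_def[symmetric] sign by (auto simp: sgn_if)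
    with abs_scaled_err_le_max_err[of w xstar c k i] show ?thesis by linarith
  next
    case False
    with abs_scaled_err_Suc_le[OF run \<beta>, of k i] show ?thesis
      unfolding h_def by linarith
  qed
qed

lemma excess_nonneg: "0 \<le> excess \<beta> \<theta> r0 \<eta> k"
  by (induction k) auto

lemma max_err_le_radius_excess:
  assumes run: "band_run \<beta> \<theta> r0 w xstar c s \<eta>" and \<beta>: "1 / 2 \<le> \<beta>" "\<beta> \<le> 1" and \<theta>: "0 \<le> \<theta>"
  shows "max_err w xstar c k \<le> radius \<beta> r0 k + excess \<beta> \<theta> r0 \<eta> k"
proof (induction k)
  case 0
  then show ?case
    using run unfolding band_run_def by (simp add: radius_def)
next
  case (Suc k)
  let ?M = "max_err w xstar c k" and ?R = "radius \<beta> r0 k" and ?d = "excess \<beta> \<theta> r0 \<eta> k"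
  have R: "0 \<le> ?R"
    using run \<beta> unfolding band_run_def by (simp add: radius_nonneg)
  have "?M - (1 - \<beta>) * ?R \<le> \<beta> * ?R + ?d"
    using Suc by (simp add: algebra_simps)
  moreover have "(1 - \<beta>) * ?R \<le> \<beta> * ?R"
    using R \<beta> by (intro mult_right_mono) auto
  moreover have "\<theta> * ?M + \<eta> k + (1 - \<beta>) * ?R \<le> \<beta> * ?R + (\<theta> * ?d + \<eta> k - Delta \<beta> \<theta> * ?R)"
    using mult_left_mono[OF Suc \<theta>] by (simp add: Delta_def algebra_simps)
  ultimately show ?case
    using max_err_Suc_le[OF run, of k] excess_nonneg[of \<beta> \<theta> r0 \<eta> k] \<beta>
    unfolding radius_Suc excess.simps by linarith
qed

lemma excess_le_fixed_point:
  assumes \<theta>: "0 \<le> \<theta>" "\<theta> < 1" and A: "0 \<le> A"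
    and forcing: "\<And>j. j < K \<Longrightarrow> \<eta> j - Delta \<beta> \<theta> * radius \<beta> r0 j \<le> A"
  shows "excess \<beta> \<theta> r0 \<eta> K \<le> A / (1 - \<theta>)"
  using forcing
proof (induction K)
  case 0
  then show ?case using \<theta> A by simp
next
  case (Suc K)
  have IH: "excess \<beta> \<theta> r0 \<eta> K \<le> A / (1 - \<theta>)"
    using Suc by simp
  have "\<theta> * excess \<beta> \<theta> r0 \<eta> K + (\<eta> K - Delta \<beta> \<theta> * radius \<beta> r0 K) \<le> \<theta> * (A / (1 - \<theta>)) + A"
    using mult_left_mono[OF IH \<theta>(1)] Suc.prems[of K] by simp
  also have "\<dots> = A / (1 - \<theta>)"
    using \<theta> by (simp add: field_simps)
  finally show ?case using IH by simp
qed

lemma max_err_convergent: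
  assumes run: "band_run \<beta> \<theta> r0 w xstar c s \<eta>" and \<beta>: "0 \<le> \<beta>" "\<beta> < 1"
  shows "convergent (max_err w xstar c)"
proof -
  let ?f = "\<lambda>k. max_err w xstar c k + radius \<beta> r0 k"
  have "0 < r0"
    using run unfolding band_run_def by blast
  have "max_err w xstar c (Suc k) \<le> max_err w xstar c k + (1 - \<beta>) * radius \<beta> r0 k" for k
    unfolding max_err_le_iff
  proof
    fix i
    show "\<bar>scaled_err w xstar c (Suc k) $ i\<bar> \<le> max_err w xstar c k + (1 - \<beta>) * radius \<beta> r0 k"
      using abs_scaled_err_Suc_le[OF run, of k i] abs_scaled_err_le_max_err[of w xstar c k i] \<beta>
      by linarith
  qed
  then have "decseq ?f"
    by (intro decseq_SucI) (simp add: radius_Suc algebra_simps)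
  moreover have "0 \<le> ?f k" for k
    using \<open>0 < r0\<close> \<beta> by (simp add: max_err_nonneg radius_nonneg)
  ultimately obtain L where "?f \<longlonglongrightarrow> L"
    using decseq_convergent by blast
  from tendsto_diff[OF this radius_tendsto_0[OF \<beta>, of r0]] show ?thesis
    by (auto simp: convergent_def)
qed

text \<open>
  Moving away from the target in every step uses up the whole displacement budget, the sum of all
  \<open>(1 - \<beta>) \<beta>\<^sup>k\<close>, which is \<open>1\<close>. The error \<open>2 - \<beta>\<^sup>k\<close> remains inside the band because
  \<open>(1 - \<theta>) (2 - \<beta>\<^sup>k) \<le> 2 (1 - \<theta>)\<close>.
\<close>

lemma escaping_run:
  fixes \<beta> \<theta> :: real
  assumes \<beta>: "0 \<le> \<beta>" "\<beta> < 1" and \<theta>: "\<theta> \<le> 1"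
  defines "c \<equiv> \<lambda>k. (\<chi> i. 2 - \<beta> ^ k) :: real ^ 'n"
  shows "band_run \<beta> \<theta> 1 (\<chi> i. 1) 0 c (\<lambda>k. \<chi> i. - 1) (\<lambda>k. 2 * (1 - \<theta>))" (is ?run)
    and "max_err (\<chi> i. 1) 0 c \<longlonglongrightarrow> 2" (is ?limit)
proof -
  have pow: "0 \<le> \<beta> ^ k" "\<beta> ^ k \<le> 1" for k
    using \<beta> by (simp_all add: power_le_one)
  have u: "\<bar>scaled_err (\<chi> i. 1) 0 c k $ i\<bar> = 2 - \<beta> ^ k" for k i
    using pow[of k] by (simp add: scaled_err_def c_def)
  have M: "max_err (\<chi> i. 1) 0 c = (\<lambda>k. 2 - \<beta> ^ k)"
    by (rule ext) (simp add: max_err_def u)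
  have band: "2 - \<beta> ^ k \<le> \<theta> * (2 - \<beta> ^ k) + 2 * (1 - \<theta>)" for k
  proof -
    have "(1 - \<theta>) * (2 - \<beta> ^ k) \<le> (1 - \<theta>) * 2"
      using \<theta> pow by (intro mult_left_mono) auto
    then show ?thesis by (simp add: algebra_simps)
  qed
  show ?run
    unfolding band_run_def M u
  proof (intro conjI allI impI)
    show "s = sgn t" if "\<theta> * (2 - \<beta> ^ k) + 2 * (1 - \<theta>) < 2 - \<beta> ^ k" for s t :: real and k
      using that band[of k] by linarith
  qed (use \<theta> in \<open>auto simp: c_def vec_eq_iff radius_def algebra_simps\<close>)
  have "(\<lambda>k. 2 - \<beta> ^ k) \<longlonglongrightarrow> 2 - 0"
    using \<beta> by (intro tendsto_intros LIMSEQ_power_zero) simp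
  then show ?limit
    unfolding M by simp
qed

theorem theorem5p6:
  fixes \<beta> \<theta> :: real
  assumes "1 / 2 \<le> \<beta>" and "\<beta> < 1" and "0 \<le> \<theta>" and "\<theta> \<le> 2 * \<beta> - 1"
  shows
    "(\<forall>(r0 :: real) (w :: real ^ 'n) (xstar :: real ^ 'n) (c :: nat \<Rightarrow> real ^ 'n)
        (s :: nat \<Rightarrow> real ^ 'n) (\<eta> :: nat \<Rightarrow> real).
        band_run \<beta> \<theta> r0 w xstar c s \<eta> \<longrightarrow>
          (\<forall>K\<ge>1.
             max_err w xstar c K \<le> radius \<beta> r0 K + excess \<beta> \<theta> r0 \<eta> K \<and>
             radius \<beta> r0 K + excess \<beta> \<theta> r0 \<eta> K
               \<le> radius \<beta> r0 K
                  + Max ((\<lambda>j. max (\<eta> j - Delta \<beta> \<theta> * radius \<beta> r0 j) 0) ` {0..<K}) / (1 - \<theta>)) \<and>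
          convergent (max_err w xstar c) \<and>
          (\<forall>\<eta>bar :: real. (\<forall>k. \<eta> k \<le> \<eta>bar) \<longrightarrow>
             lim (max_err w xstar c) \<le> \<eta>bar / (1 - \<theta>))) \<and>
     (\<forall>C :: real. C < 1 / (1 - \<theta>) \<longrightarrow>
        \<not> (\<forall>(r0 :: real) (w :: real ^ 1) (xstar :: real ^ 1) (c :: nat \<Rightarrow> real ^ 1)
             (s :: nat \<Rightarrow> real ^ 1) (\<eta> :: nat \<Rightarrow> real) (\<eta>bar :: real).
             band_run \<beta> \<theta> r0 w xstar c s \<eta> \<and> (\<forall>k. \<eta> k \<le> \<eta>bar) \<longrightarrow>
               lim (max_err w xstar c) \<le> C * \<eta>bar))"
proof (intro conjI allI impI)
  have \<beta>: "0 \<le> \<beta>" and \<theta>: "\<theta> < 1" and \<Delta>: "0 \<le> Delta \<beta> \<theta>"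
    using assms by (simp_all add: Delta_def)
  {
    fix r0 :: real and w xstar :: "real ^ 'n" and c s :: "nat \<Rightarrow> real ^ 'n" and \<eta> :: "nat \<Rightarrow> real"
    assume run: "band_run \<beta> \<theta> r0 w xstar c s \<eta>"
    have bound: "max_err w xstar c K \<le> radius \<beta> r0 K + excess \<beta> \<theta> r0 \<eta> K" for K
      using max_err_le_radius_excess[OF run] assms by simp
    show "max_err w xstar c K \<le> radius \<beta> r0 K + excess \<beta> \<theta> r0 \<eta> K" for K
      by (rule bound)
    show "radius \<beta> r0 K + excess \<beta> \<theta> r0 \<eta> K
            \<le> radius \<beta> r0 K
               + Max ((\<lambda>j. max (\<eta> j - Delta \<beta> \<theta> * radius \<beta> r0 j) 0) ` {0..<K}) / (1 - \<theta>)"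
      if "1 \<le> K" for K
    proof -
      let ?A = "Max ((\<lambda>j. max (\<eta> j - Delta \<beta> \<theta> * radius \<beta> r0 j) 0) ` {0..<K})"
      have "max (\<eta> j - Delta \<beta> \<theta> * radius \<beta> r0 j) 0 \<le> ?A" if "j < K" for j
        using that by (intro Max_ge) auto
      then have "\<eta> j - Delta \<beta> \<theta> * radius \<beta> r0 j \<le> ?A" and "0 \<le> ?A" if "j < K" for j
        using that by (meson max.boundedE)+
      then have "excess \<beta> \<theta> r0 \<eta> K \<le> ?A / (1 - \<theta>)"
        using \<open>1 \<le> K\<close> by (intro excess_le_fixed_point assms \<theta>) auto
      then show ?thesis by simp
    qed
    show conv: "convergent (max_err w xstar c)"
      using run \<beta> assms(2) by (rule max_err_convergent)
    show "lim (max_err w xstar c) \<le> \<eta>bar / (1 - \<theta>)" if noise: "\<forall>k. \<eta> k \<le> \<eta>bar" for \<eta>bar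
    proof (rule LIMSEQ_le)
      have r0: "0 < r0" and "0 \<le> \<eta> 0"
        using run unfolding band_run_def by blast+
      then have "0 \<le> \<eta>bar"
        using noise order_trans by blast
      moreover have "\<eta> j - Delta \<beta> \<theta> * radius \<beta> r0 j \<le> \<eta>bar" for j
        using noise[rule_format, of j] mult_nonneg_nonneg[OF \<Delta> radius_nonneg[OF \<beta>, of r0 j]] r0
        by linarith
      ultimately have "excess \<beta> \<theta> r0 \<eta> K \<le> \<eta>bar / (1 - \<theta>)" for K
        by (intro excess_le_fixed_point assms \<theta>)
      then have "max_err w xstar c K \<le> radius \<beta> r0 K + \<eta>bar / (1 - \<theta>)" for K
        using bound[of K] by (meson add_left_mono order_trans)
      then show "\<exists>N. \<forall>K\<ge>N. max_err w xstar c K \<le> radius \<beta> r0 K + \<eta>bar / (1 - \<theta>)"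
        by blast
      show "max_err w xstar c \<longlonglongrightarrow> lim (max_err w xstar c)"
        using conv by (simp add: convergent_LIMSEQ_iff)
      show "(\<lambda>K. radius \<beta> r0 K + \<eta>bar / (1 - \<theta>)) \<longlonglongrightarrow> \<eta>bar / (1 - \<theta>)"
        using tendsto_add[OF radius_tendsto_0[OF \<beta> assms(2)] tendsto_const] by simp
    qed
  }
  fix C :: real
  assume C: "C < 1 / (1 - \<theta>)"
  show "\<not> (\<forall>(r0 :: real) (w :: real ^ 1) (xstar :: real ^ 1) (c :: nat \<Rightarrow> real ^ 1)
             (s :: nat \<Rightarrow> real ^ 1) (\<eta> :: nat \<Rightarrow> real) (\<eta>bar :: real).
             band_run \<beta> \<theta> r0 w xstar c s \<eta> \<and> (\<forall>k. \<eta> k \<le> \<eta>bar) \<longrightarrow>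
               lim (max_err w xstar c) \<le> C * \<eta>bar)"
  proof
    assume *: "\<forall>(r0 :: real) (w :: real ^ 1) (xstar :: real ^ 1) (c :: nat \<Rightarrow> real ^ 1)
             (s :: nat \<Rightarrow> real ^ 1) (\<eta> :: nat \<Rightarrow> real) (\<eta>bar :: real).
             band_run \<beta> \<theta> r0 w xstar c s \<eta> \<and> (\<forall>k. \<eta> k \<le> \<eta>bar) \<longrightarrow>
               lim (max_err w xstar c) \<le> C * \<eta>bar"
    note escape = escaping_run[where ?'n = 1, OF \<beta> assms(2) less_imp_le[OF \<theta>]]
    have "2 \<le> C * (2 * (1 - \<theta>))"
      using *[rule_format, OF conjI, OF escape(1), of "2 * (1 - \<theta>)"] limI[OF escape(2)] by simp
    moreover have "C * (1 - \<theta>) < 1"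
      using C \<theta> by (simp add: field_simps)
    ultimately show False by (simp add: algebra_simps)
  qed
qed

end
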